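(* Let $n$ and $k$ be positive integers. An $\mathrm{OMD}(n,k)$ exists only if $n \equiv 0 \pmod{2k}$.
   Context: $K_n$ denotes the complete graph on $n$ vertices, and $M_k$ denotes a matching with $k$ edges, i.e. a set of $k$ pairwise disjoint edges (so it covers exactly $2k$ vertices). An $\mathrm{OMD}(n,k)$ (orthogonally resolvable matching design) is a decomposition of the edges of $K_n$ into copies of $M_k$ (called blocks) having two orthogonal resolutions. That is, the set of blocks can be partitioned in two ways into resolution classes, a resolution class being a set of blocks whose vertex sets partition $V(K_n)$, so that any class of the first partition and any class of the second partition have at most one block in common. Equivalently, it is a square array of side $n-1$ such that: (1) each cell is either empty or contains one copy of $M_k$ with vertices in $V(K_n)$; (2) each row and each column contains each element of $V(K_n)$ exactly once, i.e. in exactly one of the blocks in that row or column; (3) every pair of distinct $x,y \in V(K_n)$ occurs as an edge of exactly one of the copies of $M_k$ in the array, exactly once.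
   Formalization: An OMD is required to have at least one block; this excludes only n = 1, where the empty set of blocks with no resolution classes would literally be an OMD(1,k) although 1 is not 0 mod 2k. For n ≥ 2 the condition is automatic. *)

theory Defs
  imports "HOL-Library.Disjoint_Sets" "HOL-Number_Theory.Cong"
begin

text \<open>
  A simple graph is given by its set of edges, an edge being a two-element set of vertices.
  The vertex set of a set of edges without isolated vertices, such as a matching, is its union.
\<close>

definition complete_graph_edges :: "'a set \<Rightarrow> 'a set set" where
  "complete_graph_edges V = {{x, y} | x y. x \<in> V \<and> y \<in> V \<and> x \<noteq> y}"

definition is_matching_copy :: "'a set \<Rightarrow> nat \<Rightarrow> 'a set set \<Rightarrow> bool" where
  "is_matching_copy V k M \<longleftrightarrow>
     M \<subseteq> complete_graph_edges V \<and> finite M \<and> card M = k \<and> disjoint M"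

definition is_matching_decomposition :: "'a set \<Rightarrow> nat \<Rightarrow> 'a set set set \<Rightarrow> bool" where
  "is_matching_decomposition V k \<B> \<longleftrightarrow>
     (\<forall>M\<in>\<B>. is_matching_copy V k M) \<and> partition_on (complete_graph_edges V) \<B>"

text \<open>
  The vertex sets are treated as a family indexed by the blocks: two distinct blocks of a class
  must have disjoint vertex sets, in particular they cannot have the same vertex set.
\<close>

definition is_resolution_class :: "'a set \<Rightarrow> 'a set set set \<Rightarrow> bool" where
  "is_resolution_class V C \<longleftrightarrow>
     disjoint_family_on (\<lambda>M. \<Union>M) C \<and> (\<Union>M\<in>C. \<Union>M) = V"

definition is_resolution :: "'a set \<Rightarrow> 'a set set set \<Rightarrow> 'a set set set set \<Rightarrow> bool" where
  "is_resolution V \<B> R \<longleftrightarrow> partition_on \<B> R \<and> (\<forall>C\<in>R. is_resolution_class V C)"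

definition orthogonal_resolutions :: "'b set set \<Rightarrow> 'b set set \<Rightarrow> bool" where
  "orthogonal_resolutions R S \<longleftrightarrow>
     (\<forall>C\<in>R. \<forall>D\<in>S. \<forall>M\<in>C \<inter> D. \<forall>N\<in>C \<inter> D. M = N)"

text \<open>
  The condition that there is a block only matters for \<open>n \<le> 1\<close>: a complete graph on at least
  two vertices has an edge, so every decomposition of it has a block.  On a single vertex
  the empty set of blocks, resolved into no classes at all, is not counted as a design.
\<close>

definition is_OMD :: "nat \<Rightarrow> nat \<Rightarrow> 'a set \<Rightarrow> 'a set set set \<Rightarrow> bool" where
  "is_OMD n k V \<B> \<longleftrightarrow>
     finite V \<and> card V = n \<and>
     is_matching_decomposition V k \<B> \<and> \<B> \<noteq> {} \<and>
     (\<exists>R S. is_resolution V \<B> R \<and> is_resolution V \<B> S \<and> orthogonal_resolutions R S)"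

end

theory Submission imports Defs begin

text \<open>The blocks of one resolution class split the \<open>n\<close> vertices among themselves,
  and each block, being \<open>k\<close> pairwise disjoint edges, covers exactly
  \<open>2 * k\<close> of them. Hence \<open>n\<close> is \<open>2 * k\<close> times the number of
  blocks in any one class. \<open>card_matching_copy_vertices\<close> counts a single block and
  \<open>card_resolution_class\<close> sums over a class.\<close>

lemma complete_graph_edge:
  assumes "e \<in> complete_graph_edges V"
  shows "e \<subseteq> V" and "finite e" and "card e = 2"
  using assms by (auto simp: complete_graph_edges_def)

lemma matching_copy_vertices_subset:
  assumes "is_matching_copy V k M"
  shows "\<Union>M \<subseteq> V"
  using assms complete_graph_edge(1) unfolding is_matching_copy_def by blast

lemma card_matching_copy_vertices:
  assumes "is_matching_copy V k M"
  shows "card (\<Union>M) = 2 * k"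
proof -
  have edges: "M \<subseteq> complete_graph_edges V" and "card M = k" and "disjoint M"
    using assms by (auto simp: is_matching_copy_def)
  have "card (\<Union>M) = (\<Sum>e\<in>M. card e)"
    using \<open>disjoint M\<close> edges complete_graph_edge(2) by (intro card_Union_disjoint) auto
  also have "\<dots> = (\<Sum>e\<in>M. 2)"
    using edges complete_graph_edge(3) by (intro sum.cong) auto
  finally show ?thesis
    using \<open>card M = k\<close> by simp
qed

text \<open>Disjointness holds for the family indexed by the blocks, so the sizes of the vertex sets
  add up over the blocks themselves, each contributing \<open>2 * k\<close>.\<close>

lemma card_resolution_class:
  assumes "finite V" and "is_resolution_class V C"
    and copies: "\<And>M. M \<in> C \<Longrightarrow> is_matching_copy V k M"
  shows "card V = card C * (2 * k)"
proof -
  have disj: "disjoint_family_on (\<lambda>M. \<Union>M) C" and cover: "(\<Union>M\<in>C. \<Union>M) = V"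
    using assms(2) by (auto simp: is_resolution_class_def)
  \<comment> \<open>A block is a set of subsets of \<open>V\<close>, so finiteness of the class is
    inherited from the double power set of \<open>V\<close>.\<close>
  have "C \<subseteq> Pow (Pow V)"
    using copies matching_copy_vertices_subset by blast
  then have "finite C"
    using \<open>finite V\<close> by (meson finite_Pow_iff finite_subset)
  have "card V = (\<Sum>M\<in>C. card (\<Union>M))"
    unfolding cover[symmetric]
  proof (rule card_UN_disjoint'[OF disj _ \<open>finite C\<close>])
    show "finite (\<Union>M)" if "M \<in> C" for M
      using matching_copy_vertices_subset[OF copies[OF that]] \<open>finite V\<close> by (rule finite_subset)
  qed
  also have "\<dots> = (\<Sum>M\<in>C. 2 * k)"
    by (intro sum.cong refl card_matching_copy_vertices[OF copies])
  finally show ?thesis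
    by simp
qed

theorem theorem1p2:
  fixes n k :: nat
  assumes "n > 0" and "k > 0"
    and "\<exists>(V :: 'a set) \<B>. is_OMD n k V \<B>"
  shows "[n = 0] (mod 2 * k)"
proof -
  obtain V :: "'a set" and \<B> R where "finite V" and "card V = n" and "\<B> \<noteq> {}"
    and copies: "\<And>M. M \<in> \<B> \<Longrightarrow> is_matching_copy V k M"
    and R: "partition_on \<B> R" and classes: "\<And>C. C \<in> R \<Longrightarrow> is_resolution_class V C"
    using assms(3) unfolding is_OMD_def is_matching_decomposition_def is_resolution_def by blast
  have "\<Union>R = \<B>"
    using R by (simp add: partition_on_def)
  \<comment> \<open>The classes cover \<open>\<B>\<close>, so any block yields a class to count
    with.\<close>
  with \<open>\<B> \<noteq> {}\<close> obtain C where "C \<in> R" and "C \<subseteq> \<B>"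
    by blast
  then have "card V = card C * (2 * k)"
    using \<open>finite V\<close> classes copies by (intro card_resolution_class) auto
  then show ?thesis
    using \<open>card V = n\<close> by (simp add: cong_0_iff)
qed

end
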